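(* Let $M$ be a matroid of finite rank with ground set $E$ containing a loop, and let $T:M\to M$ be a nilpotent strong map. Then the following are equivalent. (1) $T$ has a Jordan basis. (2) $T^m$ is complementary for all nonnegative integers $m$. (3) The Jordan bases of $T$ are exactly the orbits of the $\mathbf K$-minimal bases of $M/\mathrm I(T)$. (4) The Jordan bases of $T$ are exactly the preorbits of the $\mathbf I$-maximal bases of $M|\mathrm K(T)$.
   Context: Let $\mathrm{cl}$ and $\rho$ be the closure and rank functions of $M$; loops are the elements of $\mathrm{cl}(\emptyset)$. A strong map $T:M\to M$ is a set function $T:E\to E$ with $T(\mathrm{cl}(S))\subseteq\mathrm{cl}(T(S))$ for every $S\subseteq E$. It is nilpotent if $T^n(E)$ consists of loops for some $n$. Put $\mathrm K(T)=\{e\in E: T(e)\text{ is a loop}\}$ and $\mathrm I(T)=T(E)$. A strong map $U$ is complementary if $\rho(U(S))=\rho(S\cup \mathrm K(U))-\rho(\mathrm K(U))$ for every $S\subseteq E$. $M/X$ is the contraction of $M$ by $X$ (ground set $E\setminus X$) and $M|X$ the restriction to $X$. The orbit of an element $e$ is the (possibly empty) set of all non-loops of the form $T^m e$, $m\ge0$; the orbit of a set is the union of the orbits of its elements. A Jordan basis of $T$ is a basis of $M$ that is a disjoint union of orbits of elements. Fix $n$ with $T^n(E)$ consisting of loops. For $e\in E$ let $\mathbf K(e)$ be the least $m\ge0$ such that $T^m e$ is a loop, and let $\mathbf I(e)$ be the largest $m\in\{0,\dots,n\}$ with $e\in T^m(E)$. A basis $B$ of a minor is $\mathbf K$-minimal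 if $\sum_{b\in B}\mathbf K(b)$ is minimal among bases of that minor, and $\mathbf I$-maximal if $\sum_{b\in B}\mathbf I(b)$ is maximal among bases of that minor. A preorbit of an element $b$ is a set $\{e,Te,\dots,T^m e\}$ with $T^m e=b$ and $b\in T^m(E)\setminus T^{m+1}(E)$. A preorbit of a set $B$ is a union $\bigcup_{b\in B}J_b$ with each $J_b$ a preorbit of $b$. *)

theory Defs
  imports "HOL-Library.Disjoint_Sets"
begin

record 'a matroid =
  ground :: "'a set"
  indep :: "'a set set"

text \<open>The ground set may be infinite; finite rank is the uniform bound on the sizes of
  independent sets.\<close>

locale finite_rank_matroid =
  fixes M :: "'a matroid"
  assumes indep_subset_ground: "I \<in> indep M \<Longrightarrow> I \<subseteq> ground M"
    and indep_empty: "{} \<in> indep M"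
    and indep_mono: "I \<in> indep M \<Longrightarrow> J \<subseteq> I \<Longrightarrow> J \<in> indep M"
    and indep_augment: "I \<in> indep M \<Longrightarrow> J \<in> indep M \<Longrightarrow> card I < card J \<Longrightarrow>
      \<exists>e \<in> J - I. insert e I \<in> indep M"
    and finite_rank: "\<exists>r. \<forall>I \<in> indep M. finite I \<and> card I \<le> r"

definition basis :: "'a matroid \<Rightarrow> 'a set \<Rightarrow> bool" where
  "basis M B \<longleftrightarrow> B \<in> indep M \<and> (\<forall>I \<in> indep M. B \<subseteq> I \<longrightarrow> I = B)"

definition rank :: "'a matroid \<Rightarrow> 'a set \<Rightarrow> nat" where
  "rank M S = Max (card ` {I \<in> indep M. I \<subseteq> S})"

definition cl :: "'a matroid \<Rightarrow> 'a set \<Rightarrow> 'a set" where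
  "cl M S = {e \<in> ground M. rank M (insert e S) = rank M S}"

definition loops :: "'a matroid \<Rightarrow> 'a set" where
  "loops M = cl M {}"

definition restriction :: "'a matroid \<Rightarrow> 'a set \<Rightarrow> 'a matroid" where
  "restriction M X = \<lparr>ground = X, indep = {I \<in> indep M. I \<subseteq> X}\<rparr>"

definition contraction :: "'a matroid \<Rightarrow> 'a set \<Rightarrow> 'a matroid" where
  "contraction M X = \<lparr>ground = ground M - X,
     indep = {I. I \<subseteq> ground M - X \<and> (\<exists>B. basis (restriction M X) B \<and> I \<union> B \<in> indep M)}\<rparr>"

text \<open>A self-map of the ground set is represented by a total function on the type that maps
  the ground set into itself; its values elsewhere are irrelevant.\<close>

definition strong_map :: "'a matroid \<Rightarrow> ('a \<Rightarrow> 'a) \<Rightarrow> bool" where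
  "strong_map M T \<longleftrightarrow> T ` ground M \<subseteq> ground M \<and>
     (\<forall>S \<subseteq> ground M. T ` cl M S \<subseteq> cl M (T ` S))"

definition nilpotent_map :: "'a matroid \<Rightarrow> ('a \<Rightarrow> 'a) \<Rightarrow> bool" where
  "nilpotent_map M T \<longleftrightarrow> (\<exists>n. (T ^^ n) ` ground M \<subseteq> loops M)"

definition kernel_set :: "'a matroid \<Rightarrow> ('a \<Rightarrow> 'a) \<Rightarrow> 'a set" where
  "kernel_set M T = {e \<in> ground M. T e \<in> loops M}"

definition image_set :: "'a matroid \<Rightarrow> ('a \<Rightarrow> 'a) \<Rightarrow> 'a set" where
  "image_set M T = T ` ground M"

definition complementary :: "'a matroid \<Rightarrow> ('a \<Rightarrow> 'a) \<Rightarrow> bool" where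
  "complementary M U \<longleftrightarrow> strong_map M U \<and>
     (\<forall>S \<subseteq> ground M. int (rank M (U ` S)) =
        int (rank M (S \<union> kernel_set M U)) - int (rank M (kernel_set M U)))"

definition orbit :: "'a matroid \<Rightarrow> ('a \<Rightarrow> 'a) \<Rightarrow> 'a \<Rightarrow> 'a set" where
  "orbit M T e = {(T ^^ m) e | m. (T ^^ m) e \<notin> loops M}"

definition orbit_set :: "'a matroid \<Rightarrow> ('a \<Rightarrow> 'a) \<Rightarrow> 'a set \<Rightarrow> 'a set" where
  "orbit_set M T A = (\<Union>a \<in> A. orbit M T a)"

definition jordan_basis :: "'a matroid \<Rightarrow> ('a \<Rightarrow> 'a) \<Rightarrow> 'a set \<Rightarrow> bool" where
  "jordan_basis M T B \<longleftrightarrow> basis M B \<and>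
     (\<exists>A \<subseteq> ground M. disjoint_family_on (orbit M T) A \<and> B = (\<Union>a \<in> A. orbit M T a))"

definition K_index :: "'a matroid \<Rightarrow> ('a \<Rightarrow> 'a) \<Rightarrow> 'a \<Rightarrow> nat" where
  "K_index M T e = (LEAST m. (T ^^ m) e \<in> loops M)"

definition I_index :: "'a matroid \<Rightarrow> ('a \<Rightarrow> 'a) \<Rightarrow> nat \<Rightarrow> 'a \<Rightarrow> nat" where
  "I_index M T n e = Max {m \<in> {0..n}. e \<in> (T ^^ m) ` ground M}"

text \<open>Below, \<open>N\<close> is a minor of \<open>M\<close>; the indices are always computed in \<open>M\<close>.\<close>

definition K_minimal_basis :: "'a matroid \<Rightarrow> ('a \<Rightarrow> 'a) \<Rightarrow> 'a matroid \<Rightarrow> 'a set \<Rightarrow> bool" where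
  "K_minimal_basis M T N B \<longleftrightarrow> basis N B \<and>
     (\<forall>B'. basis N B' \<longrightarrow> (\<Sum>b\<in>B. K_index M T b) \<le> (\<Sum>b\<in>B'. K_index M T b))"

definition I_maximal_basis ::
  "'a matroid \<Rightarrow> ('a \<Rightarrow> 'a) \<Rightarrow> nat \<Rightarrow> 'a matroid \<Rightarrow> 'a set \<Rightarrow> bool" where
  "I_maximal_basis M T n N B \<longleftrightarrow> basis N B \<and>
     (\<forall>B'. basis N B' \<longrightarrow> (\<Sum>b\<in>B'. I_index M T n b) \<le> (\<Sum>b\<in>B. I_index M T n b))"

definition is_preorbit :: "'a matroid \<Rightarrow> ('a \<Rightarrow> 'a) \<Rightarrow> 'a \<Rightarrow> 'a set \<Rightarrow> bool" where
  "is_preorbit M T b J \<longleftrightarrow> (\<exists>e \<in> ground M. \<exists>m. J = {(T ^^ i) e | i. i \<le> m} \<and> (T ^^ m) e = b \<and>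
     b \<in> (T ^^ m) ` ground M - (T ^^ Suc m) ` ground M)"

definition is_preorbit_set :: "'a matroid \<Rightarrow> ('a \<Rightarrow> 'a) \<Rightarrow> 'a set \<Rightarrow> 'a set \<Rightarrow> bool" where
  "is_preorbit_set M T B P \<longleftrightarrow>
     (\<exists>J. (\<forall>b \<in> B. is_preorbit M T b (J b)) \<and> P = (\<Union>b \<in> B. J b))"

end

theory Submission
  imports Defs
begin

text \<open>
  Write \<open>r\<close> for the rank of \<open>M\<close>. The orbits of any basis of \<open>M/I(T)\<close> span \<open>M\<close>, so the sum of \<open>K\<close> over
  such a basis is at least \<open>r\<close>, and its orbits form a Jordan basis exactly when the sum equals \<open>r\<close>.
  Dually, the preorbits of any independent subset of \<open>K(T)\<close> are disjoint with independent union, so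
  the sum of \<open>I + 1\<close> over it is at most \<open>r\<close>, and they form a Jordan basis exactly when it equals \<open>r\<close>.
  Hence as soon as one Jordan basis exists, the extremal bases are those whose sum is \<open>r\<close>.

  A strong map \<open>U\<close> is complementary iff \<open>\<rho>(U(E)) + \<rho>(K(U)) = r\<close>; the inequality \<open>\<le>\<close> always holds,
  and counting the elements of a Jordan basis inside and outside \<open>K(T\<^sup>m)\<close> gives the other one.
  Conversely, a basis of \<open>M/I(T)\<close> adapted to the flag of the \<open>K(T\<^sup>j)\<close> has \<open>K\<close>-sum at most \<open>r\<close> when all
  powers of \<open>T\<close> are complementary.
\<close>

section \<open>Rank and closure\<close>

context finite_rank_matroid
begin

lemma finite_indep: "I \<in> indep M \<Longrightarrow> finite I"
  using finite_rank by blast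

lemma finite_card_indep: "finite (card ` {I \<in> indep M. I \<subseteq> S})"
proof -
  obtain r where "\<forall>I \<in> indep M. finite I \<and> card I \<le> r"
    using finite_rank by blast
  then have "card ` {I \<in> indep M. I \<subseteq> S} \<subseteq> {..r}" by auto
  then show ?thesis by (rule finite_subset) simp
qed

lemma card_le_rank: "I \<in> indep M \<Longrightarrow> I \<subseteq> S \<Longrightarrow> card I \<le> rank M S"
  unfolding rank_def by (rule Max_ge[OF finite_card_indep]) auto

lemma rank_attained:
  obtains I where "I \<in> indep M" "I \<subseteq> S" "card I = rank M S"
proof -
  have "card ` {I \<in> indep M. I \<subseteq> S} \<noteq> {}" using indep_empty by auto
  from Max_in[OF finite_card_indep this] show ?thesis
    using that unfolding rank_def by fastforce
qed

text \<open>Augmentation against one fixed maximum independent subset of \<open>S\<close> adds an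
  element at a time until the sizes agree.\<close>

lemma extend_indep:
  assumes "I \<in> indep M" "I \<subseteq> S"
  obtains J where "J \<in> indep M" "I \<subseteq> J" "J \<subseteq> S" "card J = rank M S"
proof -
  have "\<exists>J \<in> indep M. I \<subseteq> J \<and> J \<subseteq> S \<and> card J = rank M S"
    using assms
  proof (induction "rank M S - card I" arbitrary: I rule: less_induct)
    case less
    show ?case
    proof (cases "card I = rank M S")
      case True
      then show ?thesis using less.prems by blast
    next
      case False
      then have lt: "card I < rank M S"
        using card_le_rank less.prems by (simp add: nat_less_le)
      obtain J where J: "J \<in> indep M" "J \<subseteq> S" "card J = rank M S"
        by (rule rank_attained)
      then obtain e where e: "e \<in> J - I" "insert e I \<in> indep M"
        using indep_augment[of I J] lt less.prems by auto
      have "card (insert e I) = Suc (card I)"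
        using e finite_indep less.prems by simp
      then have "\<exists>K \<in> indep M. insert e I \<subseteq> K \<and> K \<subseteq> S \<and> card K = rank M S"
        using e J less.prems lt by (intro less.hyps) auto
      then show ?thesis by auto
    qed
  qed
  then show ?thesis using that by blast
qed

lemma rank_mono: "S \<subseteq> S' \<Longrightarrow> rank M S \<le> rank M S'"
  by (metis card_le_rank order_trans rank_attained)

lemma rank_le_ground: "rank M S \<le> rank M (ground M)"
  by (metis card_le_rank indep_subset_ground rank_attained)

lemma rank_indep: "I \<in> indep M \<Longrightarrow> rank M I = card I"
  by (metis card_le_rank card_mono finite_indep order_antisym order_refl rank_attained)

lemma rank_Un_le: "rank M (X \<union> Y) \<le> rank M X + rank M Y"
proof -
  obtain J where J: "J \<in> indep M" "J \<subseteq> X \<union> Y" "card J = rank M (X \<union> Y)"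
    by (rule rank_attained)
  have "card J \<le> card (J \<inter> X) + card (J \<inter> Y)"
    using J(2) card_Un_le[of "J \<inter> X" "J \<inter> Y"] by (simp add: Int_Un_distrib[symmetric] inf_absorb1)
  moreover have "card (J \<inter> X) \<le> rank M X" "card (J \<inter> Y) \<le> rank M Y"
    using J(1) by (auto intro!: card_le_rank intro: indep_mono)
  ultimately show ?thesis using J(3) by simp
qed

lemma rank_le_card: "finite S \<Longrightarrow> rank M S \<le> card S"
  by (metis card_mono rank_attained)

lemma indep_if_card_le_rank:
  assumes "finite S" "card S \<le> rank M S"
  shows "S \<in> indep M"
  by (metis assms card_seteq rank_attained)

text \<open>Maximality of \<open>I\<close> within \<open>S\<close>. It is used below to see that a
  larger independent set containing \<open>I\<close> gains nothing from \<open>S\<close>.\<close>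

lemma insert_in_indepD:
  assumes "I \<subseteq> S" "card I = rank M S" "insert e I \<in> indep M" "e \<in> S"
  shows "e \<in> I"
proof (rule ccontr)
  assume "e \<notin> I"
  moreover have "finite I" using finite_indep[OF assms(3)] by simp
  ultimately have "card (insert e I) = Suc (rank M S)" using assms by simp
  then show False using card_le_rank[OF assms(3), of S] assms by auto
qed

text \<open>One maximum independent subset of \<open>S\<close> decides membership in the closure, so
  later arguments can extend a fixed set instead of comparing ranks.\<close>

lemma cl_alt:
  assumes "I \<in> indep M" "I \<subseteq> S" "card I = rank M S" "e \<in> ground M"
  shows "e \<in> cl M S \<longleftrightarrow> e \<in> I \<or> insert e I \<notin> indep M"
proof
  assume "e \<in> cl M S"
  then have "rank M (insert e S) = card I" using assms unfolding cl_def by simp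
  then show "e \<in> I \<or> insert e I \<notin> indep M"
    using insert_in_indepD[of I "insert e S" e] assms by auto
next
  assume *: "e \<in> I \<or> insert e I \<notin> indep M"
  obtain J where J: "J \<in> indep M" "I \<subseteq> J" "J \<subseteq> insert e S" "card J = rank M (insert e S)"
    using extend_indep[OF assms(1), of "insert e S"] assms(2) by auto
  have "J \<subseteq> S"
  proof (cases "e \<in> I")
    case False
    then have "e \<notin> J" using * J indep_mono[of J "insert e I"] by auto
    then show ?thesis using J by auto
  qed (use J assms in auto)
  then have "rank M (insert e S) \<le> rank M S" using J card_le_rank by metis
  then show "e \<in> cl M S" using assms(4) rank_mono[OF subset_insertI[of S e]] unfolding cl_def by auto
qed

lemma cl_mono:
  assumes "S \<subseteq> S'"
  shows "cl M S \<subseteq> cl M S'"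
proof
  fix e assume e: "e \<in> cl M S"
  then have g: "e \<in> ground M" unfolding cl_def by simp
  obtain I where I: "I \<in> indep M" "I \<subseteq> S" "card I = rank M S" by (rule rank_attained)
  obtain J where J: "J \<in> indep M" "I \<subseteq> J" "J \<subseteq> S'" "card J = rank M S'"
    using extend_indep[OF I(1), of S'] I assms by blast
  have "e \<in> J \<or> insert e J \<notin> indep M"
    using cl_alt[OF I g] e J(2) indep_mono[of "insert e J" "insert e I"] by auto
  then show "e \<in> cl M S'" using cl_alt J g by metis
qed

lemma subset_cl_if_rank_eq:
  assumes "S \<subseteq> S'" "S' \<subseteq> ground M" "rank M S = rank M S'"
  shows "S' \<subseteq> cl M S"
proof
  fix e assume "e \<in> S'"
  then have "rank M (insert e S) \<le> rank M S" using assms rank_mono[of "insert e S" S'] by auto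
  then show "e \<in> cl M S"
    using \<open>e \<in> S'\<close> assms(2) rank_mono[OF subset_insertI[of S e]] unfolding cl_def by auto
qed

text \<open>The closure tests single elements. Each element of \<open>S'\<close> is already spanned
  by the same maximum independent subset \<open>I\<close> of \<open>S\<close>, so \<open>I\<close>
  stays maximal when all of them are added at once.\<close>

lemma rank_Un_cl:
  assumes "S' \<subseteq> cl M S"
  shows "rank M (S \<union> S') = rank M S"
proof -
  obtain I where I: "I \<in> indep M" "I \<subseteq> S" "card I = rank M S" by (rule rank_attained)
  obtain J where J: "J \<in> indep M" "I \<subseteq> J" "J \<subseteq> S \<union> S'" "card J = rank M (S \<union> S')"
    using extend_indep[OF I(1), of "S \<union> S'"] I by blast
  have "e \<in> I" if "e \<in> J" for e
  proof -
    have "insert e I \<in> indep M" using that J indep_mono[of J "insert e I"] by auto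
    moreover have "e \<in> ground M" using that J indep_subset_ground by blast
    ultimately show ?thesis
      using that J(3) assms cl_alt[OF I] insert_in_indepD[OF I(2,3)] by blast
  qed
  then show ?thesis using I J by (metis subset_antisym subsetI)
qed

lemma rank_empty: "rank M {} = 0"
  using rank_le_card[of "{}"] by simp

lemma rank_subset_loops: "S \<subseteq> loops M \<Longrightarrow> rank M S = 0"
  using rank_Un_cl[of S "{}"] rank_empty unfolding loops_def by simp

lemma rank_Un_loops: "L \<subseteq> loops M \<Longrightarrow> rank M (S \<union> L) = rank M S"
  using rank_Un_le[of S L] rank_subset_loops[of L] rank_mono[of S "S \<union> L"] by simp

lemma indep_not_loop: "I \<in> indep M \<Longrightarrow> e \<in> I \<Longrightarrow> e \<notin> loops M"
  using card_le_rank[of "{e}" "{e}"] indep_mono[of I "{e}"] rank_subset_loops[of "{e}"] by auto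

text \<open>The rank hypothesis says that \<open>S\<close> is independent in the contraction by
  \<open>Y\<close>. Growing \<open>X\<close> to a maximum independent subset \<open>C\<close> of
  \<open>Y\<close>, and \<open>C\<close> to one of \<open>S \<union> Y\<close>, adds at least
  \<open>card S\<close> elements, all taken from \<open>S\<close>.\<close>

lemma indep_Un:
  assumes "X \<in> indep M" "X \<subseteq> Y" "finite S" "rank M Y + card S \<le> rank M (S \<union> Y)"
  shows "X \<union> S \<in> indep M"
proof -
  obtain C where C: "C \<in> indep M" "X \<subseteq> C" "C \<subseteq> Y" "card C = rank M Y"
    using extend_indep[OF assms(1,2)] by blast
  obtain D where D: "D \<in> indep M" "C \<subseteq> D" "D \<subseteq> S \<union> Y" "card D = rank M (S \<union> Y)"
    using extend_indep[OF C(1), of "S \<union> Y"] C by blast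
  have "D \<inter> Y \<subseteq> C"
    using insert_in_indepD[OF C(3,4)] indep_mono[OF D(1)] D(2) by auto
  then have sub: "D - C \<subseteq> S" using D by auto
  have "card D = card C + card (D - C)"
    using D C finite_indep by (metis card_Diff_subset card_mono le_add_diff_inverse)
  then have "card S \<le> card (D - C)" using assms(4) C D by simp
  then have "D - C = S" using card_seteq[OF assms(3) sub] by simp
  then show ?thesis using indep_mono[OF D(1), of "X \<union> S"] C D by auto
qed

section \<open>Bases of minors\<close>

lemma basis_iff: "basis M B \<longleftrightarrow> B \<in> indep M \<and> card B = rank M (ground M)"
proof
  assume B: "basis M B"
  then have "B \<in> indep M" by (simp add: basis_def)
  then obtain J where "J \<in> indep M" "B \<subseteq> J" "J \<subseteq> ground M" "card J = rank M (ground M)"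
    using extend_indep[OF _ indep_subset_ground] by metis
  moreover from this have "J = B" using B unfolding basis_def by blast
  ultimately show "B \<in> indep M \<and> card B = rank M (ground M)" by simp
next
  assume B: "B \<in> indep M \<and> card B = rank M (ground M)"
  then have "I = B" if "I \<in> indep M" "B \<subseteq> I" for I
    using that card_seteq[of I B] card_le_rank[of I "ground M"] finite_indep[of I]
      indep_subset_ground[of I] by auto
  then show "basis M B" using B unfolding basis_def by auto
qed

lemma basis_restriction_iff:
  "basis (restriction M X) C \<longleftrightarrow> C \<in> indep M \<and> C \<subseteq> X \<and> card C = rank M X"
proof
  assume C: "basis (restriction M X) C"
  then have "C \<in> indep M" "C \<subseteq> X" by (auto simp: basis_def restriction_def)
  then obtain J where "J \<in> indep M" "C \<subseteq> J" "J \<subseteq> X" "card J = rank M X"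
    by (rule extend_indep)
  moreover from this have "J = C" using C unfolding basis_def restriction_def by simp
  ultimately show "C \<in> indep M \<and> C \<subseteq> X \<and> card C = rank M X" by simp
next
  assume C: "C \<in> indep M \<and> C \<subseteq> X \<and> card C = rank M X"
  have "I = C" if "I \<in> indep M" "I \<subseteq> X" "C \<subseteq> I" for I
    using that C card_seteq[of I C] card_le_rank[of I X] finite_indep[of I] by auto
  then show "basis (restriction M X) C" using C unfolding basis_def restriction_def by auto
qed

lemma indep_contraction_iff:
  "A \<in> indep (contraction M X) \<longleftrightarrow> A \<subseteq> ground M - X \<and>
     (\<exists>C \<in> indep M. C \<subseteq> X \<and> card C = rank M X \<and> A \<union> C \<in> indep M)"
  unfolding contraction_def by (auto simp: basis_restriction_iff)

lemma basis_contraction_iff: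
  "basis (contraction M X) A \<longleftrightarrow>
     A \<in> indep (contraction M X) \<and> card A + rank M X = rank M (ground M)"
proof
  assume A: "basis (contraction M X) A"
  then have AI: "A \<in> indep (contraction M X)" by (simp add: basis_def)
  then obtain C where sub: "A \<subseteq> ground M - X" and C: "C \<in> indep M" "C \<subseteq> X" "card C = rank M X"
    "A \<union> C \<in> indep M" unfolding indep_contraction_iff by blast
  obtain D where D: "D \<in> indep M" "A \<union> C \<subseteq> D" "D \<subseteq> ground M" "card D = rank M (ground M)"
    by (rule extend_indep[OF C(4) indep_subset_ground[OF C(4)]])
  \<comment> \<open>Since \<open>C\<close> is maximal in \<open>X\<close>, the extension
    \<open>D\<close> gains nothing there. So \<open>D - X\<close> is independent in the contraction
    with the same witness \<open>C\<close>, and maximality of \<open>A\<close> forces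
    \<open>D - X = A\<close>.\<close>
  have "D \<inter> X \<subseteq> C"
    using insert_in_indepD[OF C(2,3)] indep_mono[OF D(1)] D(2) by auto
  then have DX: "D \<inter> X = C" using C D by auto
  have "D - X \<in> indep (contraction M X)" unfolding indep_contraction_iff
    using C D indep_subset_ground[OF D(1)] indep_mono[OF D(1), of "(D - X) \<union> C"] by blast
  moreover have "A \<subseteq> D - X" using D sub by auto
  ultimately have "D - X = A" using A unfolding basis_def by blast
  then have "card D = card A + card C"
    using DX card_Int_Diff[OF finite_indep[OF D(1)], of X] by simp
  then show "A \<in> indep (contraction M X) \<and> card A + rank M X = rank M (ground M)"
    using AI C D by simp
next
  assume A: "A \<in> indep (contraction M X) \<and> card A + rank M X = rank M (ground M)"
  have "I = A" if I: "I \<in> indep (contraction M X)" "A \<subseteq> I" for I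
  proof -
    obtain C where sub: "I \<subseteq> ground M - X" and C: "C \<in> indep M" "C \<subseteq> X" "card C = rank M X"
      "I \<union> C \<in> indep M" using I unfolding indep_contraction_iff by blast
    have f: "finite I" "finite C" using finite_indep[OF C(4)] by auto
    have "card I + rank M X = card (I \<union> C)"
      using card_Un_disjoint[OF f] sub C(2,3) by (metis Diff_disjoint Int_mono Int_commute subset_empty)
    also have "\<dots> \<le> rank M (ground M)" using card_le_rank indep_subset_ground C(4) by blast
    finally show ?thesis using A I card_seteq[OF f(1), of A] by auto
  qed
  then show "basis (contraction M X) A" using A unfolding basis_def by blast
qed

section \<open>Strong maps\<close>

text \<open>A strong map does not enlarge rank increments: \<open>U\<close>
  S\<open>is spanned by the image of a maximum independent set\<close>J\<open>of\<close>S\<open>, and only the elements of\<close>J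
  - I\<open>contribute beyond\<close>U \<open>A\<close>. The sums avoid subtraction of
  naturals.\<close>

lemma strong_map_rank:
  assumes "strong_map M U" "A \<subseteq> S" "S \<subseteq> ground M"
  shows "rank M (U ` S) + rank M A \<le> rank M (U ` A) + rank M S"
proof -
  obtain I where I: "I \<in> indep M" "I \<subseteq> A" "card I = rank M A" by (rule rank_attained)
  obtain J where J: "J \<in> indep M" "I \<subseteq> J" "J \<subseteq> S" "card J = rank M S"
    using extend_indep[OF I(1), of S] I assms by blast
  have "S \<subseteq> cl M J" using J rank_indep assms subset_cl_if_rank_eq by metis
  then have "U ` S \<subseteq> cl M (U ` J)"
    using assms J unfolding strong_map_def by (meson image_mono subset_trans)
  then have "rank M (U ` S) \<le> rank M (U ` J)"
    using rank_Un_cl rank_mono by (metis Un_upper2)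
  also have "U ` J = U ` I \<union> U ` (J - I)" using J by auto
  also have "rank M \<dots> \<le> rank M (U ` I) + rank M (U ` (J - I))" by (rule rank_Un_le)
  also have "rank M (U ` I) \<le> rank M (U ` A)" using I by (auto intro: rank_mono)
  also have "rank M (U ` (J - I)) \<le> card (J - I)"
    using rank_le_card[of "U ` (J - I)"] card_image_le[of "J - I" U] finite_indep[OF J(1)] by simp
  also have "card (J - I) = rank M S - rank M A"
    using I J finite_indep card_Diff_subset by metis
  finally show ?thesis using rank_mono[of A S] assms by linarith
qed

lemma rank_image_loops: "U ` S \<subseteq> loops M \<Longrightarrow> rank M (U ` (S' \<union> S)) = rank M (U ` S')"
  by (simp add: image_Un rank_Un_loops)

text \<open>This is the increment inequality above the kernel, whose image has rank 0. One half of
  complementarity thus holds for every strong map.\<close>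

lemma strong_map_image_kernel_le:
  assumes "strong_map M U" "S \<subseteq> ground M"
  shows "rank M (U ` S) + rank M (kernel_set M U) \<le> rank M (S \<union> kernel_set M U)"
proof -
  have "U ` kernel_set M U \<subseteq> loops M" "kernel_set M U \<subseteq> ground M"
    unfolding kernel_set_def by auto
  then show ?thesis
    using strong_map_rank[OF assms(1), of "kernel_set M U" "S \<union> kernel_set M U"] assms(2)
      rank_image_loops[of U "kernel_set M U" S] rank_subset_loops by simp
qed

text \<open>Equality for the whole ground set is inherited by every \<open>S\<close>: the increment
  from \<open>S \<union> kernel_set M U\<close> to the ground set cannot grow under
  \<open>U\<close>, which yields the inequality opposite to
  \<open>strong_map_image_kernel_le\<close>.\<close>

lemma complementary_iff:
  "complementary M U \<longleftrightarrow> strong_map M U \<and>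
     rank M (U ` ground M) + rank M (kernel_set M U) = rank M (ground M)"
proof
  have "ground M \<union> kernel_set M U = ground M" unfolding kernel_set_def by auto
  then show "complementary M U \<Longrightarrow> strong_map M U \<and>
     rank M (U ` ground M) + rank M (kernel_set M U) = rank M (ground M)"
    unfolding complementary_def by force
next
  assume U: "strong_map M U \<and>
     rank M (U ` ground M) + rank M (kernel_set M U) = rank M (ground M)"
  have K: "U ` kernel_set M U \<subseteq> loops M" "kernel_set M U \<subseteq> ground M"
    unfolding kernel_set_def by auto
  have "rank M (U ` S) + rank M (kernel_set M U) = rank M (S \<union> kernel_set M U)"
    if S: "S \<subseteq> ground M" for S
  proof -
    have "rank M (U ` ground M) + rank M (S \<union> kernel_set M U)
        \<le> rank M (U ` S) + rank M (ground M)"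
      using strong_map_rank[of U "S \<union> kernel_set M U" "ground M"] U S K(2)
        rank_image_loops[OF K(1), of S] by simp
    then show ?thesis using strong_map_image_kernel_le[of U S] S U by linarith
  qed
  then have "int (rank M (U ` S)) = int (rank M (S \<union> kernel_set M U)) - int (rank M (kernel_set M U))"
    if "S \<subseteq> ground M" for S
    using that by (metis add_diff_cancel_right' of_nat_add)
  then show "complementary M U" using U unfolding complementary_def by simp
qed

lemma strong_map_funpow:
  assumes "strong_map M T"
  shows "strong_map M (T ^^ m)"
proof (induction m)
  case 0
  then show ?case by (simp add: strong_map_def)
next
  case (Suc m)
  then have g: "(T ^^ m) ` ground M \<subseteq> ground M" by (simp add: strong_map_def)
  have "(T ^^ Suc m) ` cl M S \<subseteq> cl M ((T ^^ Suc m) ` S)" if S: "S \<subseteq> ground M" for S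
  proof -
    have "(T ^^ Suc m) ` cl M S = T ` (T ^^ m) ` cl M S" by auto
    also have "\<dots> \<subseteq> T ` cl M ((T ^^ m) ` S)"
      using Suc S unfolding strong_map_def by (meson image_mono)
    also have "\<dots> \<subseteq> cl M (T ` (T ^^ m) ` S)"
      using assms g S unfolding strong_map_def by (meson image_mono subset_trans)
    also have "T ` (T ^^ m) ` S = (T ^^ Suc m) ` S" by auto
    finally show ?thesis .
  qed
  moreover have "(T ^^ Suc m) ` ground M \<subseteq> ground M"
    using g assms unfolding strong_map_def by auto
  ultimately show ?case unfolding strong_map_def by blast
qed

end

section \<open>Nilpotent strong maps\<close>

text \<open>The exponent \<open>n\<close> is a parameter and not an existential witness because
  \<open>I_index\<close> uses it as its cutoff.\<close>

locale nilpotent_strong_map = finite_rank_matroid M for M :: "'a matroid" +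
  fixes T :: "'a \<Rightarrow> 'a" and n :: nat
  assumes strong: "strong_map M T"
    and nilpotent: "(T ^^ n) ` ground M \<subseteq> loops M"
begin

abbreviation K :: "'a \<Rightarrow> nat" where "K \<equiv> K_index M T"
abbreviation I :: "'a \<Rightarrow> nat" where "I \<equiv> I_index M T n"

section \<open>Iterates of \<open>T\<close> and the index \<open>K\<close>\<close>

lemma strong_funpow: "strong_map M (T ^^ m)"
  by (rule strong_map_funpow[OF strong])

lemma funpow_ground: "e \<in> ground M \<Longrightarrow> (T ^^ m) e \<in> ground M"
  using strong_funpow[of m] unfolding strong_map_def by blast

lemma funpow_loops: "e \<in> loops M \<Longrightarrow> (T ^^ m) e \<in> loops M"
  using strong_funpow[of m] unfolding strong_map_def loops_def by fastforce

lemma funpow_le_loops: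
  assumes "(T ^^ i) e \<in> loops M" "i \<le> j"
  shows "(T ^^ j) e \<in> loops M"
proof -
  have "(T ^^ j) e = (T ^^ (j - i)) ((T ^^ i) e)"
    using assms(2) by (metis comp_apply funpow_add le_add_diff_inverse2)
  then show ?thesis using funpow_loops assms(1) by simp
qed

text \<open>Loops are mapped to loops, so the least exponent in \<open>K_index\<close> is a
  threshold; nilpotency ensures that it exists.\<close>

lemma funpow_loops_iff:
  assumes "e \<in> ground M"
  shows "(T ^^ m) e \<in> loops M \<longleftrightarrow> K e \<le> m"
proof
  show "(T ^^ m) e \<in> loops M \<Longrightarrow> K e \<le> m"
    unfolding K_index_def by (rule Least_le)
  have "(T ^^ n) e \<in> loops M" using nilpotent assms by auto
  then have "(T ^^ K e) e \<in> loops M" unfolding K_index_def by (rule LeastI)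
  then show "K e \<le> m \<Longrightarrow> (T ^^ m) e \<in> loops M" by (rule funpow_le_loops)
qed

lemma K_le: "e \<in> ground M \<Longrightarrow> K e \<le> n"
  using nilpotent funpow_loops_iff by blast

lemma K_pos: "e \<in> ground M \<Longrightarrow> e \<notin> loops M \<Longrightarrow> 0 < K e"
  using funpow_loops_iff[of e 0] by auto

text \<open>Truncated subtraction is right here: past the threshold every iterate is a loop and has
  index 0.\<close>

lemma K_funpow: "e \<in> ground M \<Longrightarrow> K ((T ^^ i) e) = K e - i"
proof (rule antisym)
  assume e: "e \<in> ground M"
  have "(T ^^ (K e - i)) ((T ^^ i) e) = (T ^^ (K e - i + i)) e"
    by (simp add: funpow_add)
  then show "K ((T ^^ i) e) \<le> K e - i"
    using funpow_loops_iff[OF e] funpow_loops_iff[OF funpow_ground[OF e]]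
    by (metis le_diff_conv order_refl)
  have "(T ^^ (K ((T ^^ i) e) + i)) e \<in> loops M"
    using funpow_loops_iff[OF funpow_ground[OF e, of i], of "K ((T ^^ i) e)"] by (simp add: funpow_add)
  then show "K e - i \<le> K ((T ^^ i) e)"
    using funpow_loops_iff[OF e] by (simp add: le_diff_conv)
qed

lemma kernel_funpow: "kernel_set M (T ^^ m) = {e \<in> ground M. K e \<le> m}"
  unfolding kernel_set_def using funpow_loops_iff by auto

lemma kernel_T: "kernel_set M T = {e \<in> ground M. K e \<le> 1}"
  using kernel_funpow[of 1] by simp

section \<open>Orbits of elements and sets, and their sizes\<close>

lemma orbit_alt: "e \<in> ground M \<Longrightarrow> orbit M T e = (\<lambda>i. (T ^^ i) e) ` {..<K e}"
  unfolding orbit_def using funpow_loops_iff[of e] by auto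

text \<open>The index \<open>K\<close> drops by one at each step of the orbit, so it determines the
  position.\<close>

lemma inj_on_orbit: "e \<in> ground M \<Longrightarrow> inj_on (\<lambda>i. (T ^^ i) e) {..<K e}"
  by (intro inj_onI) (metis K_funpow diff_diff_cancel lessThan_iff less_imp_le)

lemma card_orbit: "e \<in> ground M \<Longrightarrow> card (orbit M T e) = K e"
  by (simp add: orbit_alt card_image inj_on_orbit)

lemma finite_orbit: "e \<in> ground M \<Longrightarrow> finite (orbit M T e)"
  by (simp add: orbit_alt)

lemma orbit_subset: "e \<in> ground M \<Longrightarrow> orbit M T e \<subseteq> ground M - loops M"
  unfolding orbit_def using funpow_ground by auto

lemma self_in_orbit: "e \<notin> loops M \<Longrightarrow> e \<in> orbit M T e"
  unfolding orbit_def by (auto intro: exI[of _ 0])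

lemma orbit_loop: "e \<in> loops M \<Longrightarrow> orbit M T e = {}"
  unfolding orbit_def using funpow_loops by auto

lemma card_orbit_set:
  assumes "finite A" "A \<subseteq> ground M" "disjoint_family_on (orbit M T) A"
  shows "card (orbit_set M T A) = (\<Sum>a\<in>A. K a)"
proof -
  have "card (orbit_set M T A) = (\<Sum>a\<in>A. card (orbit M T a))"
    unfolding orbit_set_def using assms finite_orbit
    by (intro card_UN_disjoint) (auto simp: disjoint_family_on_def)
  then show ?thesis using assms(2) card_orbit by (simp add: subset_eq)
qed

lemma card_orbit_set_le:
  assumes "finite A" "A \<subseteq> ground M"
  shows "card (orbit_set M T A) \<le> (\<Sum>a\<in>A. K a)"
proof -
  have "card (orbit_set M T A) \<le> (\<Sum>a\<in>A. card (orbit M T a))"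
    unfolding orbit_set_def by (rule card_UN_le[OF assms(1)])
  then show ?thesis using assms(2) card_orbit by (simp add: subset_eq)
qed

text \<open>If two orbits met, their common elements would be counted twice in the sum, making it
  exceed the size of the union.\<close>

lemma disjoint_orbits_if_card:
  assumes "finite A" "A \<subseteq> ground M" "(\<Sum>a\<in>A. K a) \<le> card (orbit_set M T A)"
  shows "disjoint_family_on (orbit M T) A"
proof (rule ccontr)
  assume "\<not> ?thesis"
  then obtain a b where ab: "a \<in> A" "b \<in> A" "a \<noteq> b" "orbit M T a \<inter> orbit M T b \<noteq> {}"
    unfolding disjoint_family_on_def by blast
  let ?A = "A - {a, b}"
  have fin: "finite (orbit M T a)" "finite (orbit M T b)"
    using finite_orbit ab assms(2) by auto
  have "orbit_set M T A = orbit_set M T ?A \<union> (orbit M T a \<union> orbit M T b)"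
    unfolding orbit_set_def using ab by auto
  then have "card (orbit_set M T A) \<le> card (orbit_set M T ?A) + card (orbit M T a \<union> orbit M T b)"
    by (simp add: card_Un_le)
  also have "card (orbit M T a \<union> orbit M T b) < card (orbit M T a) + card (orbit M T b)"
    using card_Un_Int[OF fin] ab(4) fin by (simp add: card_gt_0_iff)
  also have "card (orbit_set M T ?A) \<le> (\<Sum>a\<in>?A. K a)"
    using assms by (intro card_orbit_set_le) auto
  finally have "card (orbit_set M T A) < (\<Sum>a\<in>?A. K a) + (K a + K b)"
    using card_orbit ab assms(2) by (auto simp: subset_eq)
  also have "\<dots> = (\<Sum>a\<in>A. K a)"
    using ab assms(1) sum.subset_diff[of "{a, b}" A K] by simp
  finally show False using assms(3) by simp
qed

lemma jordan_basisE:
  assumes "jordan_basis M T B"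
  obtains A where "A \<subseteq> ground M - loops M" "finite A" "disjoint_family_on (orbit M T) A"
    "B = orbit_set M T A" "B \<in> indep M" "card B = rank M (ground M)"
proof -
  obtain A where A: "A \<subseteq> ground M" "disjoint_family_on (orbit M T) A" "B = (\<Union>a\<in>A. orbit M T a)"
    and B: "B \<in> indep M" "card B = rank M (ground M)"
    using assms unfolding jordan_basis_def basis_iff by blast
  let ?A = "A - loops M"
  have eq: "B = orbit_set M T ?A"
    unfolding A(3) orbit_set_def using orbit_loop by auto
  have "?A \<subseteq> B" unfolding eq orbit_set_def using self_in_orbit by auto
  then have "finite ?A" using finite_indep[OF B(1)] finite_subset by blast
  moreover have "disjoint_family_on (orbit M T) ?A"
    using A(2) by (rule disjoint_family_on_mono[rotated]) auto
  ultimately show ?thesis using that[of ?A] A B eq by auto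
qed

lemma jordan_basisI:
  assumes "A \<subseteq> ground M" "disjoint_family_on (orbit M T) A"
    "orbit_set M T A \<in> indep M" "card (orbit_set M T A) = rank M (ground M)"
  shows "jordan_basis M T (orbit_set M T A)"
  using assms unfolding jordan_basis_def basis_iff orbit_set_def by blast

text \<open>In a disjoint union of orbits a non-loop has unique coordinates: its generator and its
  exponent.\<close>

lemma same_orbit:
  assumes "A \<subseteq> ground M" "disjoint_family_on (orbit M T) A" "a \<in> A" "b \<in> A"
    "(T ^^ i) a = (T ^^ j) b" "(T ^^ i) a \<notin> loops M"
  shows "a = b \<and> i = j"
proof -
  have "(T ^^ i) a \<in> orbit M T a" unfolding orbit_def using assms(6) by blast
  moreover have "(T ^^ i) a \<in> orbit M T b" unfolding orbit_def using assms(5,6) by auto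
  ultimately have "a = b" using assms(2-4) unfolding disjoint_family_on_def by blast
  moreover have "i < K a" "j < K b"
    using assms funpow_loops_iff by (metis not_le subsetD)+
  ultimately show ?thesis using inj_on_orbit[of a] assms unfolding inj_on_def by auto
qed

section \<open>Jordan bases and complementary powers\<close>

text \<open>The part of \<open>B\<close> outside the kernel \<open>N\<close> of
  \<open>T ^^ m\<close> is mapped injectively into \<open>B\<close>, so its image is independent and
  bounds the rank of the image from below; \<open>B \<inter> N\<close> does the same for
  \<open>N\<close>. Together they count all of \<open>B\<close>.\<close>

lemma complementary_if_jordan_basis:
  assumes "jordan_basis M T B"
  shows "complementary M (T ^^ m)"
proof -
  obtain A where A: "A \<subseteq> ground M - loops M" "disjoint_family_on (orbit M T) A"
    and B: "B = orbit_set M T A" "B \<in> indep M" "card B = rank M (ground M)"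
    by (rule jordan_basisE[OF assms])
  have fin: "finite B" using B(2) by (rule finite_indep)
  have BE: "B \<subseteq> ground M" using B(2) by (rule indep_subset_ground)
  define N where "N = kernel_set M (T ^^ m)"
  have nonloop: "(T ^^ m) b \<notin> loops M" if "b \<in> B - N" for b
    using that BE unfolding N_def kernel_set_def by auto
  have B_form: "\<exists>a\<in>A. \<exists>i. b = (T ^^ i) a" if "b \<in> B" for b
    using that unfolding B(1) orbit_set_def orbit_def by auto
  \<comment> \<open>\<open>T ^^ m\<close> shifts exponents by \<open>m\<close>, and the result is
    not a loop, so \<open>same_orbit\<close> recovers generator and exponent.\<close>
  have "inj_on (T ^^ m) (B - N)"
  proof (rule inj_onI)
    fix b c assume b: "b \<in> B - N" and c: "c \<in> B - N" and eq: "(T ^^ m) b = (T ^^ m) c"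
    obtain a i where a: "a \<in> A" "b = (T ^^ i) a" using B_form b by blast
    obtain a' j where a': "a' \<in> A" "c = (T ^^ j) a'" using B_form c by blast
    have "(T ^^ (m + i)) a = (T ^^ (m + j)) a'" using eq a a' by (simp add: funpow_add)
    moreover have "(T ^^ (m + i)) a \<notin> loops M" using nonloop[OF b] a by (simp add: funpow_add)
    ultimately have "a = a' \<and> m + i = m + j"
      using same_orbit[OF _ A(2) a(1) a'(1)] A(1) by blast
    then show "b = c" using a a' by simp
  qed
  then have "card ((T ^^ m) ` (B - N)) = card (B - N)" by (rule card_image)
  moreover have "(T ^^ m) ` (B - N) \<subseteq> B"
  proof
    fix x assume "x \<in> (T ^^ m) ` (B - N)"
    then obtain b where b: "b \<in> B - N" "x = (T ^^ m) b" by blast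
    then obtain a i where a: "a \<in> A" "b = (T ^^ i) a" using B_form by blast
    have "x = (T ^^ (m + i)) a" using a b by (simp add: funpow_add)
    then have "x \<in> orbit M T a" unfolding orbit_def using nonloop[OF b(1)] b(2) by auto
    then show "x \<in> B" using a unfolding B(1) orbit_set_def by auto
  qed
  ultimately have "card (B - N) \<le> rank M ((T ^^ m) ` ground M)"
    using BE card_le_rank[OF indep_mono[OF B(2)], of "(T ^^ m) ` (B - N)" "(T ^^ m) ` ground M"]
    by auto
  moreover have "card (B \<inter> N) \<le> rank M N"
    by (intro card_le_rank indep_mono[OF B(2)]) auto
  moreover have "card B = card (B \<inter> N) + card (B - N)"
    using card_Int_Diff[OF fin] by blast
  moreover have "rank M ((T ^^ m) ` ground M) + rank M N \<le> rank M (ground M \<union> N)"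
    unfolding N_def using strong_map_image_kernel_le[OF strong_funpow] by blast
  moreover have "ground M \<union> N = ground M" unfolding N_def kernel_set_def by auto
  ultimately show ?thesis
    unfolding complementary_iff N_def[symmetric] using strong_funpow B(3) by simp
qed

section \<open>Orbits of bases of the contraction by the image\<close>

text \<open>With a maximum independent subset \<open>C\<close> of the image,
  \<open>A \<union> C\<close> spans. Applying \<open>T ^^ j\<close> leaves \<open>A\<close> inside
  its orbits up to loops and pushes \<open>C\<close> into the next image, so the part not yet
  covered by orbits retreats until it consists of loops.\<close>

lemma orbit_set_spans:
  assumes "basis (contraction M (image_set M T)) A"
  shows "rank M (orbit_set M T A) = rank M (ground M)"
proof -
  let ?O = "orbit_set M T A"
  obtain C where A: "A \<subseteq> ground M" "A \<inter> image_set M T = {}"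
    and C: "C \<in> indep M" "C \<subseteq> image_set M T" "card C = rank M (image_set M T)" "A \<union> C \<in> indep M"
    and card: "card A + rank M (image_set M T) = rank M (ground M)"
    using assms unfolding basis_contraction_iff indep_contraction_iff by blast
  have "card (A \<union> C) = card A + card C"
    using finite_indep[OF C(4)] A C by (intro card_Un_disjoint) auto
  then have rank_AC: "rank M (A \<union> C) = rank M (ground M)"
    using rank_indep[OF C(4)] C(3) card by simp
  have CE: "C \<subseteq> T ` ground M" using C(2) unfolding image_set_def .
  have "rank M (?O \<union> (T ^^ j) ` ground M) = rank M (ground M)" for j
  proof (induction j)
    case 0
    show ?case by (rule antisym[OF rank_le_ground]) (simp add: rank_mono)
  next
    case (Suc j)
    let ?S = "(T ^^ j) ` (A \<union> C)"
    have AC: "A \<union> C \<subseteq> ground M" using C(4) by (rule indep_subset_ground)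
    have "ground M \<subseteq> cl M (A \<union> C)"
      using AC rank_AC by (intro subset_cl_if_rank_eq) auto
    then have "(T ^^ j) ` ground M \<subseteq> cl M ?S"
      using strong_funpow[of j] AC unfolding strong_map_def by (meson image_mono subset_trans)
    also have "\<dots> \<subseteq> cl M (?O \<union> ?S)" by (rule cl_mono) auto
    finally have "rank M (?O \<union> ?S \<union> (T ^^ j) ` ground M) = rank M (?O \<union> ?S)"
      by (rule rank_Un_cl)
    moreover have "rank M (?O \<union> (T ^^ j) ` ground M) \<le> rank M (?O \<union> ?S \<union> (T ^^ j) ` ground M)"
      by (rule rank_mono) auto
    ultimately have "rank M (ground M) \<le> rank M (?O \<union> ?S)" using Suc by simp
    \<comment> \<open>Elements of \<open>C\<close> are values of \<open>T\<close>, so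
      \<open>T ^^ j\<close> sends them into the image of the next power.\<close>
    also have "?S \<subseteq> ?O \<union> loops M \<union> (T ^^ Suc j) ` ground M"
    proof -
      have "(T ^^ j) ` A \<subseteq> ?O \<union> loops M" unfolding orbit_set_def orbit_def by auto
      moreover have "(T ^^ j) ` C \<subseteq> (T ^^ j) ` T ` ground M" using CE by (rule image_mono)
      moreover have "(T ^^ j) ` T ` ground M = (T ^^ Suc j) ` ground M"
        by (simp add: funpow_Suc_right image_comp del: funpow.simps)
      ultimately show ?thesis by auto
    qed
    then have "rank M (?O \<union> ?S) \<le> rank M ((?O \<union> (T ^^ Suc j) ` ground M) \<union> loops M)"
      by (intro rank_mono) auto
    also have "\<dots> = rank M (?O \<union> (T ^^ Suc j) ` ground M)" by (rule rank_Un_loops) simp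
    finally show ?case using rank_le_ground by (simp add: antisym)
  qed
  from this[of n] show ?thesis using rank_Un_loops[OF nilpotent] by simp
qed

lemma basis_contractionD:
  assumes "basis (contraction M (image_set M T)) A"
  shows "finite A" "A \<subseteq> ground M" "rank M (ground M) \<le> (\<Sum>a\<in>A. K a)"
proof -
  show A: "finite A" "A \<subseteq> ground M"
    using assms finite_indep unfolding basis_contraction_iff indep_contraction_iff by blast+
  have "finite (orbit_set M T A)"
    unfolding orbit_set_def using A finite_orbit by auto
  then show "rank M (ground M) \<le> (\<Sum>a\<in>A. K a)"
    using orbit_set_spans[OF assms] rank_le_card card_orbit_set_le[OF A] by (metis order_trans)
qed

text \<open>A spanning set with no more elements than the rank is a basis. Its size then reaches the
  sum of \<open>K\<close>, which leaves no room for overlapping orbits.\<close>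

lemma jordan_basis_if_K_sum:
  assumes "basis (contraction M (image_set M T)) A" "(\<Sum>a\<in>A. K a) \<le> rank M (ground M)"
  shows "jordan_basis M T (orbit_set M T A)"
proof -
  note A = basis_contractionD[OF assms(1)]
  have fin: "finite (orbit_set M T A)" unfolding orbit_set_def using A finite_orbit by auto
  have rank: "rank M (orbit_set M T A) = rank M (ground M)"
    by (rule orbit_set_spans[OF assms(1)])
  have le: "card (orbit_set M T A) \<le> rank M (ground M)"
    using card_orbit_set_le[OF A(1,2)] assms(2) by simp
  then have indep: "orbit_set M T A \<in> indep M"
    using indep_if_card_le_rank[OF fin] rank by simp
  then have card: "card (orbit_set M T A) = rank M (ground M)"
    using rank_indep rank by simp
  show ?thesis
    using A indep card assms(2) disjoint_orbits_if_card by (intro jordan_basisI) auto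
qed

text \<open>The non-generators \<open>C\<close> of the Jordan basis \<open>B\<close> form a maximum
  independent subset of the image: they are values of \<open>T\<close>, and \<open>T\<close> sends
  the spanning set \<open>B\<close> into \<open>C\<close> and loops. So \<open>A\<close> is what
  completes a basis of the image to one of \<open>M\<close>.\<close>

lemma generators_of_jordan_basis:
  assumes "A \<subseteq> ground M - loops M" "finite A" "disjoint_family_on (orbit M T) A"
    "orbit_set M T A \<in> indep M" "card (orbit_set M T A) = rank M (ground M)"
  shows "basis (contraction M (image_set M T)) A"
proof -
  define B where "B = orbit_set M T A"
  define C where "C = B - A"
  have B: "B \<in> indep M" "card B = rank M (ground M)" "B \<subseteq> ground M"
    using assms(4,5) indep_subset_ground unfolding B_def by auto
  have AB: "A \<subseteq> B" unfolding B_def orbit_set_def using self_in_orbit assms(1) by auto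
  have cardB: "card B = card A + card C"
    using AB finite_indep[OF B(1)] assms(2) unfolding C_def
    by (metis card_Diff_subset card_mono le_add_diff_inverse)
  have CI: "C \<in> indep M" using indep_mono[OF B(1)] unfolding C_def by auto
  have C_image: "C \<subseteq> image_set M T"
  proof
    fix c assume "c \<in> C"
    then obtain a i where a: "a \<in> A" "c = (T ^^ i) a" "c \<notin> A"
      unfolding C_def B_def orbit_set_def orbit_def by blast
    then obtain j where "i = Suc j" by (cases i) auto
    then show "c \<in> image_set M T"
      using a funpow_ground[of a j] assms(1) unfolding image_set_def by auto
  qed
  have "T ` B \<subseteq> C \<union> loops M"
  proof
    fix x assume "x \<in> T ` B"
    then obtain a i where a: "a \<in> A" "x = (T ^^ Suc i) a"
      unfolding B_def orbit_set_def orbit_def by auto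
    show "x \<in> C \<union> loops M"
    proof (cases "x \<in> loops M")
      case False
      then have "x \<in> orbit M T a" using a(2) unfolding orbit_def by blast
      then have "x \<in> B" unfolding B_def orbit_set_def using a(1) by auto
      \<comment> \<open>A generator has exponent 0 in its own orbit, whereas \<open>x\<close> occurs
        with the positive exponent \<open>Suc i\<close>.\<close>
      moreover have "x \<notin> A"
        using same_orbit[OF _ assms(3) a(1), of x "Suc i" 0] a(2) assms(1) False by auto
      ultimately show ?thesis unfolding C_def by simp
    qed simp
  qed
  moreover have "ground M \<subseteq> cl M B"
    using B rank_indep by (intro subset_cl_if_rank_eq) auto
  then have "image_set M T \<subseteq> cl M (T ` B)"
    using strong B(3) unfolding strong_map_def image_set_def by (meson image_mono subset_trans)
  ultimately have "image_set M T \<subseteq> cl M (C \<union> loops M)" using cl_mono by blast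
  then have "rank M (image_set M T) \<le> rank M (C \<union> loops M)"
    using rank_Un_cl rank_mono by (metis Un_upper2)
  also have "\<dots> = card C" using rank_Un_loops[of "loops M" C] rank_indep[OF CI] by simp
  finally have cardC: "card C = rank M (image_set M T)"
    using card_le_rank[OF CI C_image] by simp
  \<comment> \<open>\<open>C\<close> is maximal in the image, so a generator lying in the image
    would belong to \<open>C\<close>, which excludes \<open>A\<close>.\<close>
  have "A \<inter> image_set M T \<subseteq> C"
    using insert_in_indepD[OF C_image cardC] indep_mono[OF B(1)] AB unfolding C_def by auto
  then have "A \<subseteq> ground M - image_set M T" using assms(1) unfolding C_def by auto
  moreover have "A \<union> C \<in> indep M" using AB B(1) unfolding C_def by (simp add: Un_absorb1)
  ultimately show ?thesis
    unfolding basis_contraction_iff indep_contraction_iff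
    using CI C_image cardC cardB B(2) by auto
qed

text \<open>The rank bounds every sum of \<open>K\<close> from below by
  \<open>basis_contractionD\<close>, and the generators of a Jordan basis attain it. Minimal
  therefore means attaining the bound.\<close>

lemma K_minimal_basis_iff:
  assumes "jordan_basis M T B"
  shows "K_minimal_basis M T (contraction M (image_set M T)) A \<longleftrightarrow>
    basis (contraction M (image_set M T)) A \<and> (\<Sum>a\<in>A. K a) \<le> rank M (ground M)"
proof -
  obtain A' where A': "A' \<subseteq> ground M - loops M" "finite A'" "disjoint_family_on (orbit M T) A'"
    "B = orbit_set M T A'" "B \<in> indep M" "card B = rank M (ground M)"
    by (rule jordan_basisE[OF assms])
  have "basis (contraction M (image_set M T)) A'"
    using generators_of_jordan_basis A' by simp
  moreover have "(\<Sum>a\<in>A'. K a) = rank M (ground M)"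
    using card_orbit_set[OF A'(2) _ A'(3)] A'(1,4,6) by (metis Diff_subset order_trans)
  ultimately show ?thesis
    unfolding K_minimal_basis_def using basis_contractionD(3) by (metis order_trans)
qed

lemma jordan_bases_eq_orbits:
  assumes "jordan_basis M T B\<^sub>0"
  shows "{B. jordan_basis M T B} =
    {orbit_set M T A | A. K_minimal_basis M T (contraction M (image_set M T)) A}"
proof (intro equalityI subsetI)
  fix B assume "B \<in> {B. jordan_basis M T B}"
  then obtain A where A: "A \<subseteq> ground M - loops M" "finite A" "disjoint_family_on (orbit M T) A"
    "B = orbit_set M T A" "B \<in> indep M" "card B = rank M (ground M)"
    using jordan_basisE by blast
  moreover have "(\<Sum>a\<in>A. K a) = rank M (ground M)"
    using card_orbit_set[OF A(2) _ A(3)] A(1,4,6) by (metis Diff_subset order_trans)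
  ultimately have "K_minimal_basis M T (contraction M (image_set M T)) A"
    unfolding K_minimal_basis_iff[OF assms] using generators_of_jordan_basis by simp
  then show "B \<in> {orbit_set M T A | A. K_minimal_basis M T (contraction M (image_set M T)) A}"
    using A(4) by blast
next
  fix B assume "B \<in> {orbit_set M T A | A. K_minimal_basis M T (contraction M (image_set M T)) A}"
  then show "B \<in> {B. jordan_basis M T B}"
    using jordan_basis_if_K_sum unfolding K_minimal_basis_iff[OF assms] by blast
qed

text \<open>This keeps condition (3) from holding with both families empty, so that (3) produces a
  Jordan basis.\<close>

lemma ex_K_minimal_basis: "\<exists>A. K_minimal_basis M T (contraction M (image_set M T)) A"
proof -
  let ?basis = "basis (contraction M (image_set M T))"
  obtain C where C: "C \<in> indep M" "C \<subseteq> image_set M T" "card C = rank M (image_set M T)"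
    by (rule rank_attained)
  obtain D where D: "D \<in> indep M" "C \<subseteq> D" "D \<subseteq> ground M" "card D = rank M (ground M)"
    by (rule extend_indep[OF C(1) indep_subset_ground[OF C(1)]])
  have "D \<inter> image_set M T \<subseteq> C"
    using insert_in_indepD[OF C(2,3)] indep_mono[OF D(1)] D(2) by auto
  then have "D - C \<in> indep (contraction M (image_set M T))"
    unfolding indep_contraction_iff using C D by (auto simp: Un_absorb2)
  moreover have "card (D - C) + card C = card D"
    using D(1,2) C(1) finite_indep by (metis card_Diff_subset card_mono le_add_diff_inverse2)
  ultimately have "?basis (D - C)" unfolding basis_contraction_iff using C D by simp
  then have "\<exists>A. ?basis A \<and> (\<forall>B. ?basis B \<longrightarrow> (\<Sum>a\<in>A. K a) \<le> (\<Sum>b\<in>B. K b))"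
    by (rule ex_has_least_nat)
  then show ?thesis unfolding K_minimal_basis_def .
qed

section \<open>Bases adapted to the flag of kernels\<close>

text \<open>For \<open>j = n\<close> and complementary powers of \<open>T\<close>, the bound telescopes to the rank of \<open>M\<close>.\<close>

lemma flag_adapted_indep:
  fixes \<rho> :: "nat \<Rightarrow> nat"
  defines "\<rho> j \<equiv> rank M (image_set M T \<union> kernel_set M (T ^^ j))"
  assumes C: "C \<in> indep M" "C \<subseteq> image_set M T" "card C = rank M (image_set M T)"
  shows "\<exists>A. A \<subseteq> kernel_set M (T ^^ j) - image_set M T \<and> A \<union> C \<in> indep M \<and>
    card (A \<union> C) = \<rho> j \<and> (\<Sum>a\<in>A. K a) \<le> (\<Sum>i<j. \<rho> j - \<rho> i)"
proof (induction j)
  case 0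
  have "rank M (image_set M T \<union> kernel_set M (T ^^ 0)) = rank M (image_set M T)"
    by (rule rank_Un_loops) (auto simp: kernel_set_def)
  then show ?case using C unfolding \<rho>_def by (intro exI[of _ "{}"]) (simp add: image_set_def)
next
  case (Suc j)
  then obtain A where A: "A \<subseteq> kernel_set M (T ^^ j) - image_set M T" "A \<union> C \<in> indep M"
    "card (A \<union> C) = \<rho> j" "(\<Sum>a\<in>A. K a) \<le> (\<Sum>i<j. \<rho> j - \<rho> i)" by blast
  let ?S = "image_set M T \<union> kernel_set M (T ^^ Suc j)"
  have Kmono: "kernel_set M (T ^^ i) \<subseteq> kernel_set M (T ^^ k)" if "i \<le> k" for i k
    unfolding kernel_funpow using that by auto
  have \<rho>_mono: "\<rho> i \<le> \<rho> k" if "i \<le> k" for i k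
    unfolding \<rho>_def using Kmono[OF that] by (intro rank_mono) auto
  have "A \<union> C \<subseteq> ?S" using A(1) C(2) Kmono[of j "Suc j"] by auto
  from extend_indep[OF A(2) this]
  obtain D where D: "D \<in> indep M" "A \<union> C \<subseteq> D" "D \<subseteq> ?S" "card D = rank M ?S" .
  \<comment> \<open>All new elements of \<open>D\<close> avoid the image and lie in the next kernel,
    so each has \<open>K\<close> at most \<open>Suc j\<close>.\<close>
  have "D \<inter> image_set M T \<subseteq> C"
    using insert_in_indepD[OF C(2,3)] indep_mono[OF D(1)] D(2) by auto
  then have new: "D - C \<subseteq> kernel_set M (T ^^ Suc j) - image_set M T" using D(3) by auto
  have fin: "finite D" using D(1) by (rule finite_indep)
  have AC: "A \<inter> C = {}" using A(1) C(2) by auto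
  have "card (D - (A \<union> C)) = card D - card (A \<union> C)"
    using D(2) fin finite_subset by (intro card_Diff_subset) auto
  then have card_new: "card (D - (A \<union> C)) = \<rho> (Suc j) - \<rho> j"
    using A(3) D(4) unfolding \<rho>_def by simp
  have "(\<Sum>a\<in>D - C. K a) = (\<Sum>a\<in>D - (A \<union> C). K a) + (\<Sum>a\<in>A. K a)"
  proof -
    have "D - C = (D - (A \<union> C)) \<union> A" using D(2) AC by auto
    moreover have "finite A" using A(2) finite_indep by blast
    moreover have "(D - (A \<union> C)) \<inter> A = {}" by auto
    ultimately show ?thesis using fin by (simp add: sum.union_disjoint)
  qed
  also have "(\<Sum>a\<in>D - (A \<union> C). K a) \<le> card (D - (A \<union> C)) * Suc j"
    using sum_bounded_above[of "D - (A \<union> C)" K "Suc j"] new unfolding kernel_funpow by auto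
  also have "\<dots> = (\<Sum>i<Suc j. \<rho> (Suc j) - \<rho> j)" unfolding card_new by simp
  \<comment> \<open>The added term at \<open>i = j\<close> is 0; it gives both sums the same range,
    so that they combine termwise, by monotonicity of \<open>\<rho>\<close>.\<close>
  also have "\<dots> + (\<Sum>a\<in>A. K a) \<le> (\<Sum>i<Suc j. \<rho> (Suc j) - \<rho> j) + (\<Sum>i<Suc j. \<rho> j - \<rho> i)"
    using A(4) by simp
  also have "\<dots> = (\<Sum>i<Suc j. \<rho> (Suc j) - \<rho> i)"
    unfolding sum.distrib[symmetric] using \<rho>_mono by (intro sum.cong) auto
  finally have "(\<Sum>a\<in>D - C. K a) \<le> (\<Sum>i<Suc j. \<rho> (Suc j) - \<rho> i)" by simp
  moreover have "D - C \<union> C = D" using D(2) by auto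
  moreover have "card D = \<rho> (Suc j)" using D(4) unfolding \<rho>_def .
  ultimately show ?case using new D(1) by (intro exI[of _ "D - C"]) (simp del: funpow.simps)
qed

text \<open>It suffices to bound the \<open>K\<close>-sum of the flag-adapted set at
  \<open>n\<close> by the rank. Complementarity turns each increment of \<open>\<rho>\<close> into a
  drop of the image ranks \<open>\<sigma>\<close>, and these drops telescope.\<close>

lemma jordan_basis_if_complementary:
  assumes "\<And>m. complementary M (T ^^ m)"
  shows "\<exists>B. jordan_basis M T B"
proof -
  obtain C where C: "C \<in> indep M" "C \<subseteq> image_set M T" "card C = rank M (image_set M T)"
    by (rule rank_attained)
  define \<rho> where "\<rho> j = rank M (image_set M T \<union> kernel_set M (T ^^ j))" for j
  define \<sigma> where "\<sigma> j = rank M ((T ^^ j) ` ground M)" for j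
  obtain A where A: "A \<subseteq> kernel_set M (T ^^ n) - image_set M T" "A \<union> C \<in> indep M"
    "card (A \<union> C) = \<rho> n" "(\<Sum>a\<in>A. K a) \<le> (\<Sum>i<n. \<rho> n - \<rho> i)"
    using flag_adapted_indep[OF C, of n] unfolding \<rho>_def by blast
  have imE: "image_set M T \<subseteq> ground M" using strong unfolding image_set_def strong_map_def by simp
  have kn: "kernel_set M (T ^^ n) = ground M" unfolding kernel_funpow using K_le by auto
  then have \<rho>n: "\<rho> n = rank M (ground M)"
    unfolding \<rho>_def using imE by (simp add: image_set_def sup.absorb2)
  have "card (A \<union> C) = card A + card C"
    using finite_indep[OF A(2)] A(1) C(2) by (intro card_Un_disjoint) auto
  then have "basis (contraction M (image_set M T)) A"
    unfolding basis_contraction_iff indep_contraction_iff using A C \<rho>n kn by auto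
  \<comment> \<open>Complementarity of \<open>T ^^ i\<close> is used twice, for the image of
    \<open>T\<close> and for the ground set; the rank of the kernel cancels.\<close>
  moreover have diff: "\<rho> n - \<rho> i = \<sigma> i - \<sigma> (Suc i)" for i
  proof -
    have "(T ^^ i) ` image_set M T = (T ^^ Suc i) ` ground M"
      by (simp add: image_set_def funpow_Suc_right image_comp del: funpow.simps)
    moreover have "int (rank M ((T ^^ i) ` image_set M T)) = int (\<rho> i) - int (rank M (kernel_set M (T ^^ i)))"
      using assms[of i] imE unfolding complementary_def \<rho>_def by (simp add: image_set_def)
    ultimately have "int (\<sigma> (Suc i)) = int (\<rho> i) - int (rank M (kernel_set M (T ^^ i)))"
      unfolding \<sigma>_def by simp
    moreover have "\<sigma> i + rank M (kernel_set M (T ^^ i)) = rank M (ground M)"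
      using assms[of i] unfolding complementary_iff \<sigma>_def by simp
    ultimately show ?thesis unfolding \<rho>n by linarith
  qed
  have "\<sigma> (Suc i) \<le> \<sigma> i" for i
    unfolding \<sigma>_def using strong
    by (intro rank_mono) (auto simp: funpow_Suc_right strong_map_def simp del: funpow.simps)
  then have step: "\<sigma> i - \<sigma> (Suc i) + \<sigma> (Suc i) = \<sigma> i" for i by simp
  have "(\<Sum>i<j. \<sigma> i - \<sigma> (Suc i)) + \<sigma> j = \<sigma> 0" for j
    by (induction j) (simp_all only: sum.lessThan_Suc add.assoc step, simp)
  from this[of n] have "(\<Sum>i<n. \<rho> n - \<rho> i) \<le> rank M (ground M)"
    unfolding diff by (simp add: \<sigma>_def)
  ultimately show ?thesis using jordan_basis_if_K_sum A(4) order_trans by blast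
qed

section \<open>Preorbits of bases of the restriction to the kernel\<close>

text \<open>The orbits are built up in layers of equal \<open>K\<close>. On the layer with
  \<open>K x = Suc k\<close>, the map \<open>T ^^ k\<close> is injective into the independent set of
  ends, and \<open>strong_map_image_kernel_le\<close> pulls this back to independence over the
  kernel of \<open>T ^^ k\<close>.\<close>

lemma orbit_set_indep_if_ends_indep:
  assumes A: "A \<subseteq> ground M - loops M"
    and inj: "inj_on (\<lambda>a. (T ^^ (K a - 1)) a) A"
    and ends: "(\<lambda>a. (T ^^ (K a - 1)) a) ` A \<in> indep M"
  shows "orbit_set M T A \<in> indep M" "disjoint_family_on (orbit M T) A"
proof -
  define tip where "tip a = (T ^^ (K a - 1)) a" for a
  let ?O = "orbit_set M T A"
  have OE: "?O \<subseteq> ground M" using A orbit_subset unfolding orbit_set_def by blast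
  have inj_tip: "a = b" if "a \<in> A" "b \<in> A" "tip a = tip b" for a b
    using inj that unfolding inj_on_def tip_def by blast
  \<comment> \<open>Every element of an orbit has the same last non-loop, so the tip identifies the
    orbit.\<close>
  have tip_orbit: "tip x = tip a" if a: "a \<in> A" and x: "x \<in> orbit M T a" for a x
  proof -
    have "a \<in> ground M" using that A by blast
    then obtain i where i: "i < K a" "x = (T ^^ i) a"
      using x orbit_alt by auto
    then have "K x - 1 + i = K a - 1" using that A K_funpow[of a i] by auto
    then show ?thesis unfolding tip_def i(2)
      by (metis comp_apply funpow_add i(2))
  qed
  show disj: "disjoint_family_on (orbit M T) A"
    unfolding disjoint_family_on_def using tip_orbit inj_tip by (metis disjoint_iff)
  have "?O \<inter> kernel_set M (T ^^ k) \<in> indep M" for k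
  proof (induction k)
    case 0
    have "?O \<inter> kernel_set M (T ^^ 0) = {}"
      unfolding orbit_set_def orbit_def kernel_set_def by auto
    then show ?case by (simp only: indep_empty)
  next
    case (Suc k)
    let ?N = "kernel_set M (T ^^ k)"
    define S where "S = {x \<in> ?O. K x = Suc k}"
    have tip_S: "(T ^^ k) x = tip x" if "x \<in> S" for x
      using that unfolding S_def tip_def by simp
    \<comment> \<open>Equal tips put \<open>x\<close> and \<open>y\<close> in the orbit of one
      generator, and equal \<open>K\<close> puts them at the same position there.\<close>
    have "inj_on (T ^^ k) S"
    proof (rule inj_onI)
      fix x y assume S: "x \<in> S" "y \<in> S" and "(T ^^ k) x = (T ^^ k) y"
      then have "tip x = tip y" using tip_S by simp
      moreover obtain a where a: "a \<in> A" "x \<in> orbit M T a"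
        using S unfolding S_def orbit_set_def by auto
      moreover obtain b where b: "b \<in> A" "y \<in> orbit M T b"
        using S unfolding S_def orbit_set_def by auto
      ultimately have "a = b" using tip_orbit inj_tip by metis
      moreover have aE: "a \<in> ground M" using a A by auto
      ultimately obtain i j where ij: "i < K a" "x = (T ^^ i) a" "j < K a" "y = (T ^^ j) a"
        using a b orbit_alt[of a] by auto
      have "K a - i = K a - j"
        using S K_funpow[OF aE] ij unfolding S_def by (metis (mono_tags, lifting) mem_Collect_eq)
      then have "i = j" using ij(1,3) by linarith
      then show "x = y" using ij by simp
    qed
    moreover have sub: "(T ^^ k) ` S \<subseteq> tip ` A"
    proof
      fix y assume "y \<in> (T ^^ k) ` S"
      then obtain x where x: "x \<in> S" "y = tip x" using tip_S by auto
      then obtain a where "a \<in> A" "x \<in> orbit M T a"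
        unfolding S_def orbit_set_def by auto
      then show "y \<in> tip ` A" using x tip_orbit by auto
    qed
    moreover have tipA: "tip ` A \<in> indep M" using ends unfolding tip_def .
    ultimately have card: "card S = rank M ((T ^^ k) ` S)" and fin: "finite S"
      using rank_indep[OF indep_mono[OF tipA sub]] finite_indep[OF indep_mono[OF tipA sub]]
      by (auto simp: card_image finite_image_iff)
    have "S \<subseteq> ground M" using OE unfolding S_def by auto
    \<comment> \<open>This is the hypothesis of \<open>indep_Un\<close> for adding the layer
      \<open>S\<close> to what lies in the kernel \<open>?N\<close>.\<close>
    then have "rank M ?N + card S \<le> rank M (S \<union> ?N)"
      using strong_map_image_kernel_le[OF strong_funpow, of S k] card by simp
    then have "(?O \<inter> ?N) \<union> S \<in> indep M"
      by (intro indep_Un[OF Suc _ fin]) auto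
    moreover have "?O \<inter> kernel_set M (T ^^ Suc k) = (?O \<inter> ?N) \<union> S"
      unfolding S_def kernel_funpow using OE by auto
    ultimately show ?case by (simp only:)
  qed
  from this[of n] show "?O \<in> indep M"
  proof -
    have "?O \<subseteq> kernel_set M (T ^^ n)" unfolding kernel_funpow using OE K_le by auto
    then show ?thesis using \<open>?O \<inter> kernel_set M (T ^^ n) \<in> indep M\<close> by (simp add: Int_absorb2)
  qed
qed

section \<open>The index \<open>I\<close> and preorbits\<close>

lemma image_funpow_antimono:
  assumes "i \<le> j"
  shows "(T ^^ j) ` ground M \<subseteq> (T ^^ i) ` ground M"
proof -
  have "T ^^ j = (T ^^ i) \<circ> (T ^^ (j - i))"
    using assms by (metis funpow_add le_add_diff_inverse)
  then show ?thesis using funpow_ground by auto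
qed

text \<open>The images decrease, so \<open>I\<close> is a threshold. The cutoff at \<open>n\<close>
  loses nothing, since from the power \<open>n\<close> on the images contain only loops.\<close>

lemma in_image_funpow_iff:
  assumes "b \<in> ground M" "b \<notin> loops M"
  shows "b \<in> (T ^^ m) ` ground M \<longleftrightarrow> m \<le> I b"
proof -
  let ?S = "{m \<in> {0..n}. b \<in> (T ^^ m) ` ground M}"
  have fin: "finite ?S" by simp
  have "0 \<in> ?S" using assms(1) by simp
  then have "I b \<in> ?S" unfolding I_index_def using Max_in[OF fin] by blast
  then have "m \<le> I b \<Longrightarrow> b \<in> (T ^^ m) ` ground M"
    using image_funpow_antimono[of m "I b"] by auto
  moreover have "m \<le> I b" if b: "b \<in> (T ^^ m) ` ground M"
  proof -
    have "\<not> n \<le> m" using image_funpow_antimono[of n m] nilpotent assms(2) b by auto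
    then show ?thesis unfolding I_index_def using b by (intro Max_ge[OF fin]) simp
  qed
  ultimately show ?thesis by blast
qed

text \<open>The length of a preorbit is forced to be \<open>I b\<close>. As \<open>b\<close> is a
  non-loop sent to a loop, the chain ending in \<open>b\<close> is the full orbit of its first
  element, so the results on orbits apply.\<close>

lemma is_preorbit_iff:
  assumes "b \<in> kernel_set M T" "b \<notin> loops M"
  shows "is_preorbit M T b J \<longleftrightarrow>
    (\<exists>e \<in> ground M. J = orbit M T e \<and> K e = Suc (I b) \<and> (T ^^ I b) e = b)"
proof -
  have bE: "b \<in> ground M" using assms(1) unfolding kernel_T by simp
  have Kb: "K b = 1" using assms K_pos[OF bE] unfolding kernel_T by auto
  have level: "b \<in> (T ^^ m) ` ground M - (T ^^ Suc m) ` ground M \<longleftrightarrow> m = I b" for m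
    unfolding Diff_iff in_image_funpow_iff[OF bE assms(2)] by auto
  have len: "K e = Suc m" if "e \<in> ground M" "(T ^^ m) e = b" for e m
    using K_funpow[OF that(1), of m] Kb unfolding that(2) by simp
  have orb: "{(T ^^ i) e | i. i \<le> m} = orbit M T e" if "e \<in> ground M" "(T ^^ m) e = b" for e m
    unfolding orbit_alt[OF that(1)] len[OF that] by auto
  show ?thesis
  proof
    assume "is_preorbit M T b J"
    then obtain e m where e: "e \<in> ground M" "(T ^^ m) e = b" "m = I b"
      and J: "J = {(T ^^ i) e | i. i \<le> m}"
      unfolding is_preorbit_def level by (elim bexE exE conjE)
    have "J = orbit M T e" using orb[OF e(1,2)] J by simp
    then show "\<exists>e \<in> ground M. J = orbit M T e \<and> K e = Suc (I b) \<and> (T ^^ I b) e = b"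
      using e len[OF e(1,2)] by (intro bexI[OF _ e(1)]) simp
  next
    assume "\<exists>e \<in> ground M. J = orbit M T e \<and> K e = Suc (I b) \<and> (T ^^ I b) e = b"
    then obtain e where e: "e \<in> ground M" "J = orbit M T e" "(T ^^ I b) e = b" by blast
    show "is_preorbit M T b J"
      unfolding is_preorbit_def level
      by (rule bexI[OF _ e(1)], rule exI[of _ "I b"]) (simp add: orb[OF e(1,3)] e)
  qed
qed

lemma ex_preorbit_set:
  assumes "A \<in> indep M" "A \<subseteq> kernel_set M T"
  shows "\<exists>P. is_preorbit_set M T A P"
proof -
  have "\<exists>J. is_preorbit M T b J" if b: "b \<in> A" for b
  proof -
    have bE: "b \<in> ground M" and bL: "b \<notin> loops M" and bK: "b \<in> kernel_set M T"
      using assms b indep_subset_ground indep_not_loop by auto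
    obtain e where e: "e \<in> ground M" "(T ^^ I b) e = b"
      using in_image_funpow_iff[OF bE bL, of "I b"] by auto
    have "K e = Suc (I b)"
      using K_funpow[OF e(1), of "I b"] K_pos[OF bE bL] bK unfolding e(2) kernel_T by auto
    then show ?thesis using is_preorbit_iff[OF bK bL] e by blast
  qed
  then obtain J where "\<forall>b\<in>A. is_preorbit M T b (J b)" by metis
  then show ?thesis unfolding is_preorbit_set_def by blast
qed

lemma preorbit_setE:
  assumes "is_preorbit_set M T A P" "A \<in> indep M" "A \<subseteq> kernel_set M T"
  obtains A' where "A' \<subseteq> ground M" "disjoint_family_on (orbit M T) A'" "P = orbit_set M T A'"
    "P \<in> indep M" "card P = (\<Sum>b\<in>A. Suc (I b))"
proof -
  obtain J where J: "\<forall>b\<in>A. is_preorbit M T b (J b)" "P = (\<Union>b\<in>A. J b)"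
    using assms(1) unfolding is_preorbit_set_def by blast
  have nl: "b \<notin> loops M" if "b \<in> A" for b using assms(2) that by (rule indep_not_loop)
  have "\<forall>b\<in>A. \<exists>e. e \<in> ground M \<and> J b = orbit M T e \<and> K e = Suc (I b) \<and> (T ^^ I b) e = b"
  proof
    fix b assume b: "b \<in> A"
    have "b \<in> kernel_set M T" using b assms(3) by blast
    from is_preorbit_iff[OF this nl[OF b], of "J b"] b J(1)
    show "\<exists>e. e \<in> ground M \<and> J b = orbit M T e \<and> K e = Suc (I b) \<and> (T ^^ I b) e = b"
      by (simp add: Bex_def)
  qed
  then obtain h where h: "\<And>b. b \<in> A \<Longrightarrow> h b \<in> ground M"
    "\<And>b. b \<in> A \<Longrightarrow> J b = orbit M T (h b)" "\<And>b. b \<in> A \<Longrightarrow> K (h b) = Suc (I b)"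
    "\<And>b. b \<in> A \<Longrightarrow> (T ^^ I b) (h b) = b"
    by metis
  let ?tip = "\<lambda>a. (T ^^ (K a - 1)) a"
  \<comment> \<open>The chosen starting points \<open>h b\<close> have the elements of
    \<open>A\<close> as ends, so independence of \<open>A\<close> passes to the union of the
    preorbits.\<close>
  have tip: "?tip (h b) = b" if "b \<in> A" for b using h(3,4) that by simp
  have inj_h: "inj_on h A" by (rule inj_on_inverseI[of _ ?tip]) (rule tip)
  have inj_tip: "inj_on ?tip (h ` A)" using tip by (auto intro: inj_onI)
  have "?tip ` h ` A = A" using tip by (force simp: image_image)
  then have tips: "?tip ` h ` A \<in> indep M" using assms(2) by simp
  have hE: "h ` A \<subseteq> ground M" using h(1) by auto
  have hA: "h ` A \<subseteq> ground M - loops M"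
  proof
    fix e assume "e \<in> h ` A"
    then obtain b where b: "b \<in> A" "e = h b" by blast
    have "e \<notin> loops M" using funpow_loops[of e "I b"] h(4)[OF b(1)] nl[OF b(1)] b(2) by auto
    then show "e \<in> ground M - loops M" using h(1) b by auto
  qed
  note orbits = orbit_set_indep_if_ends_indep[OF hA inj_tip tips]
  have P: "P = orbit_set M T (h ` A)" unfolding J(2) orbit_set_def using h(2) by auto
  have "card P = (\<Sum>a\<in>h ` A. K a)"
    unfolding P using finite_indep[OF assms(2)] hE orbits(2) by (intro card_orbit_set) auto
  also have "\<dots> = (\<Sum>b\<in>A. Suc (I b))"
    using h(3) by (simp add: sum.reindex[OF inj_h])
  finally show ?thesis using that[OF hE orbits(2) P] orbits(1) P by simp
qed

lemma I_sum_le: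
  assumes "A \<in> indep M" "A \<subseteq> kernel_set M T"
  shows "(\<Sum>b\<in>A. Suc (I b)) \<le> rank M (ground M)"
proof -
  obtain P where "is_preorbit_set M T A P" using ex_preorbit_set[OF assms] by blast
  then obtain A' where "P \<in> indep M" "card P = (\<Sum>b\<in>A. Suc (I b))"
    using preorbit_setE[OF _ assms] by metis
  then show ?thesis using card_le_rank indep_subset_ground by metis
qed

lemma jordan_basis_if_I_sum:
  assumes "is_preorbit_set M T A P" "A \<in> indep M" "A \<subseteq> kernel_set M T"
    "rank M (ground M) \<le> (\<Sum>b\<in>A. Suc (I b))"
  shows "jordan_basis M T P"
proof -
  obtain A' where A': "A' \<subseteq> ground M" "disjoint_family_on (orbit M T) A'" "P = orbit_set M T A'"
    "P \<in> indep M" "card P = (\<Sum>b\<in>A. Suc (I b))"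
    by (rule preorbit_setE[OF assms(1-3)])
  have "card P = rank M (ground M)" using A'(5) assms(4) I_sum_le[OF assms(2,3)] by simp
  then show ?thesis using jordan_basisI A' by simp
qed

text \<open>The last non-loops of the orbits form the required basis. That each orbit is a preorbit
  of its end, and not a chain that could be prolonged backwards, follows by counting.\<close>

lemma ends_of_jordan_basis:
  assumes "jordan_basis M T B"
  obtains A where "basis (restriction M (kernel_set M T)) A" "is_preorbit_set M T A B"
    "(\<Sum>b\<in>A. Suc (I b)) = rank M (ground M)"
proof -
  obtain A where A: "A \<subseteq> ground M - loops M" "finite A" "disjoint_family_on (orbit M T) A"
    and B: "B = orbit_set M T A" "B \<in> indep M" "card B = rank M (ground M)"
    by (rule jordan_basisE[OF assms])
  define tip where "tip a = (T ^^ (K a - 1)) a" for a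
  have AE: "a \<in> ground M" "a \<notin> loops M" if "a \<in> A" for a using A(1) that by auto
  have tip_nl: "tip a \<notin> loops M" if "a \<in> A" for a
    using funpow_loops_iff[OF AE(1)[OF that]] K_pos[OF AE[OF that]] unfolding tip_def by simp
  have tipE: "tip a \<in> ground M" if "a \<in> A" for a
    unfolding tip_def using AE(1)[OF that] by (rule funpow_ground)
  have inj: "inj_on tip A"
  proof (rule inj_onI)
    fix a b assume "a \<in> A" "b \<in> A" "tip a = tip b"
    then show "a = b"
      using same_orbit[OF _ A(3), of a b] A(1) tip_nl[of a] unfolding tip_def by blast
  qed
  have tip_K: "tip ` A \<subseteq> kernel_set M T"
    unfolding kernel_T using tipE K_funpow AE(1) unfolding tip_def by auto
  have "tip a \<in> orbit M T a" if "a \<in> A" for a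
    using tip_nl[OF that] unfolding tip_def orbit_def by blast
  then have "tip ` A \<subseteq> B" unfolding B(1) orbit_set_def by auto
  then have indep: "tip ` A \<in> indep M" by (rule indep_mono[OF B(2)])
  have card_tip: "card (tip ` A) = card A" using inj by (rule card_image)
  \<comment> \<open>There are as many ends as generators, namely the corank of the image;
    complementarity of \<open>T\<close> equates this with the rank of the kernel.\<close>
  have "basis (contraction M (image_set M T)) A"
    using generators_of_jordan_basis A B by simp
  then have "card A + rank M (image_set M T) = rank M (ground M)"
    unfolding basis_contraction_iff by simp
  moreover have "rank M (image_set M T) + rank M (kernel_set M T) = rank M (ground M)"
    using complementary_if_jordan_basis[OF assms, of 1]
    unfolding complementary_iff image_set_def by simp
  ultimately have "card (tip ` A) = rank M (kernel_set M T)" using card_tip by simp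
  then have basis: "basis (restriction M (kernel_set M T)) (tip ` A)"
    unfolding basis_restriction_iff using indep tip_K by simp
  have K_le_I: "K a \<le> Suc (I (tip a))" if "a \<in> A" for a
    using in_image_funpow_iff[OF tipE[OF that] tip_nl[OF that], of "K a - 1"] AE(1)[OF that]
    unfolding tip_def by auto
  have sumK: "(\<Sum>a\<in>A. K a) = rank M (ground M)"
    using card_orbit_set[OF A(2) _ A(3)] A(1) B(1,3) by (metis Diff_subset order_trans)
  have reindex: "(\<Sum>b\<in>tip ` A. Suc (I b)) = (\<Sum>a\<in>A. Suc (I (tip a)))"
    using sum.reindex[OF inj] by simp
  \<comment> \<open>The termwise inequality \<open>K_le_I\<close> and the upper bound
    \<open>I_sum_le\<close> squeeze the sums, which forces equality in every term.\<close>
  have sumI: "(\<Sum>a\<in>A. K a) = (\<Sum>a\<in>A. Suc (I (tip a)))"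
  proof (rule antisym)
    show "(\<Sum>a\<in>A. K a) \<le> (\<Sum>a\<in>A. Suc (I (tip a)))" using K_le_I by (rule sum_mono)
    show "(\<Sum>a\<in>A. Suc (I (tip a))) \<le> (\<Sum>a\<in>A. K a)"
      using I_sum_le[OF indep tip_K] unfolding sumK reindex .
  qed
  have KI: "K a = Suc (I (tip a))" if "a \<in> A" for a
    using sum_mono_inv[OF sumI K_le_I that A(2)] .
  have "is_preorbit M T (tip a) (orbit M T a)" if "a \<in> A" for a
  proof -
    have "I (tip a) = K a - 1" using KI[OF that] by simp
    then have "(T ^^ I (tip a)) a = tip a" by (simp add: tip_def)
    moreover have "tip a \<in> kernel_set M T" using tip_K that by blast
    ultimately show ?thesis
      unfolding is_preorbit_iff[OF \<open>tip a \<in> kernel_set M T\<close> tip_nl[OF that]]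
      using KI[OF that] by (intro bexI[OF _ AE(1)[OF that]]) simp
  qed
  \<comment> \<open>Preorbits are indexed by ends, so the generator is recovered by inverting
    \<open>tip\<close>.\<close>
  then have "\<forall>b\<in>tip ` A. is_preorbit M T b (orbit M T (inv_into A tip b))"
    using inj by simp
  moreover have "B = (\<Union>b\<in>tip ` A. orbit M T (inv_into A tip b))"
    unfolding B(1) orbit_set_def using inj by simp
  ultimately have "is_preorbit_set M T (tip ` A) B"
    unfolding is_preorbit_set_def by (intro exI[of _ "\<lambda>b. orbit M T (inv_into A tip b)"] conjI)
  then show ?thesis using that basis reindex sumI sumK by simp
qed

text \<open>All bases of the restriction have the same size, so maximizing the sum of
  \<open>I\<close> is maximizing that of \<open>Suc (I b)\<close>. The rank bounds the latter, and
  the ends of a Jordan basis attain it.\<close>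

lemma I_maximal_basis_iff:
  assumes "jordan_basis M T B"
  shows "I_maximal_basis M T n (restriction M (kernel_set M T)) A \<longleftrightarrow>
    basis (restriction M (kernel_set M T)) A \<and> (\<Sum>b\<in>A. Suc (I b)) = rank M (ground M)"
proof -
  let ?basis = "basis (restriction M (kernel_set M T))"
  have sum: "(\<Sum>b\<in>A. Suc (I b)) = (\<Sum>b\<in>A. I b) + rank M (kernel_set M T)" if "?basis A" for A
    using that unfolding basis_restriction_iff by (simp add: sum_Suc)
  have le: "(\<Sum>b\<in>A. Suc (I b)) \<le> rank M (ground M)" if "?basis A" for A
    using that I_sum_le unfolding basis_restriction_iff by blast
  obtain A' where A': "?basis A'" "(\<Sum>b\<in>A'. Suc (I b)) = rank M (ground M)"
    using ends_of_jordan_basis[OF assms] by metis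
  show ?thesis
  proof
    assume A: "I_maximal_basis M T n (restriction M (kernel_set M T)) A"
    then have "?basis A" "(\<Sum>b\<in>A'. I b) \<le> (\<Sum>b\<in>A. I b)"
      using A'(1) unfolding I_maximal_basis_def by auto
    then show "?basis A \<and> (\<Sum>b\<in>A. Suc (I b)) = rank M (ground M)"
      using sum[OF A'(1)] sum[of A] A'(2) le[of A] by linarith
  next
    assume A: "?basis A \<and> (\<Sum>b\<in>A. Suc (I b)) = rank M (ground M)"
    have "(\<Sum>b\<in>A''. I b) \<le> (\<Sum>b\<in>A. I b)" if "?basis A''" for A''
      using sum[of A] sum[OF that] le[OF that] A by linarith
    then show "I_maximal_basis M T n (restriction M (kernel_set M T)) A"
      unfolding I_maximal_basis_def using A by blast
  qed
qed

lemma jordan_bases_eq_preorbits: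
  assumes "jordan_basis M T B\<^sub>0"
  shows "{B. jordan_basis M T B} =
    {P. \<exists>A. I_maximal_basis M T n (restriction M (kernel_set M T)) A \<and> is_preorbit_set M T A P}"
proof -
  have "jordan_basis M T P \<longleftrightarrow> (\<exists>A. basis (restriction M (kernel_set M T)) A \<and>
      (\<Sum>b\<in>A. Suc (I b)) = rank M (ground M) \<and> is_preorbit_set M T A P)" for P
  proof
    assume "jordan_basis M T P"
    then show "\<exists>A. basis (restriction M (kernel_set M T)) A \<and>
      (\<Sum>b\<in>A. Suc (I b)) = rank M (ground M) \<and> is_preorbit_set M T A P"
      by (rule ends_of_jordan_basis) blast
  next
    assume "\<exists>A. basis (restriction M (kernel_set M T)) A \<and>
      (\<Sum>b\<in>A. Suc (I b)) = rank M (ground M) \<and> is_preorbit_set M T A P"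
    then show "jordan_basis M T P"
      unfolding basis_restriction_iff using jordan_basis_if_I_sum by (metis order_refl)
  qed
  then show ?thesis unfolding I_maximal_basis_iff[OF assms] by blast
qed

text \<open>As for (3), condition (4) must not be satisfied by two empty families. The maximum
  exists because \<open>I_sum_le\<close> bounds the sums.\<close>

lemma ex_I_maximal_basis: "\<exists>A. I_maximal_basis M T n (restriction M (kernel_set M T)) A"
proof -
  let ?basis = "basis (restriction M (kernel_set M T))"
  obtain C where C: "C \<in> indep M" "C \<subseteq> kernel_set M T" "card C = rank M (kernel_set M T)"
    by (rule rank_attained)
  then have "?basis C" unfolding basis_restriction_iff by simp
  moreover have "(\<Sum>b\<in>A. I b) < Suc (rank M (ground M))" if "?basis A" for A
  proof -
    have "(\<Sum>b\<in>A. I b) \<le> (\<Sum>b\<in>A. Suc (I b))" by (rule sum_mono) simp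
    then show ?thesis using that I_sum_le[of A] unfolding basis_restriction_iff by linarith
  qed
  ultimately have "\<exists>A. ?basis A \<and> (\<forall>B. ?basis B \<longrightarrow> (\<Sum>b\<in>B. I b) \<le> (\<Sum>a\<in>A. I a))"
    by (intro ex_has_greatest_nat[where b = "Suc (rank M (ground M))"]) (auto intro: less_imp_le)
  then show ?thesis unfolding I_maximal_basis_def .
qed

lemma jordan_basis_if_eq_orbits:
  assumes "{B. jordan_basis M T B} =
    {orbit_set M T A | A. K_minimal_basis M T (contraction M (image_set M T)) A}"
  shows "\<exists>B. jordan_basis M T B"
  using assms ex_K_minimal_basis by blast

lemma jordan_basis_if_eq_preorbits:
  assumes "{B. jordan_basis M T B} =
    {P. \<exists>A. I_maximal_basis M T n (restriction M (kernel_set M T)) A \<and> is_preorbit_set M T A P}"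
  shows "\<exists>B. jordan_basis M T B"
proof -
  obtain A where A: "I_maximal_basis M T n (restriction M (kernel_set M T)) A"
    using ex_I_maximal_basis by blast
  then have "\<exists>P. is_preorbit_set M T A P"
    unfolding I_maximal_basis_def basis_restriction_iff using ex_preorbit_set by blast
  then show ?thesis using A assms by blast
qed

end

theorem corollary5p1p9:
  fixes M :: "'a matroid" and T :: "'a \<Rightarrow> 'a" and n :: nat
  assumes "finite_rank_matroid M"
    and "loops M \<noteq> {}"
    and "strong_map M T"
    and "nilpotent_map M T"
    and "(T ^^ n) ` ground M \<subseteq> loops M"
  shows "((\<exists>B. jordan_basis M T B) \<longleftrightarrow> (\<forall>m. complementary M (T ^^ m)))
    \<and> ((\<forall>m. complementary M (T ^^ m)) \<longleftrightarrow>
        {B. jordan_basis M T B} =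
          {orbit_set M T A | A. K_minimal_basis M T (contraction M (image_set M T)) A})
    \<and> ({B. jordan_basis M T B} =
          {orbit_set M T A | A. K_minimal_basis M T (contraction M (image_set M T)) A} \<longleftrightarrow>
        {B. jordan_basis M T B} =
          {P. \<exists>A. I_maximal_basis M T n (restriction M (kernel_set M T)) A \<and> is_preorbit_set M T A P})"
proof -
  interpret nilpotent_strong_map M T n
    using assms by (simp add: nilpotent_strong_map_def nilpotent_strong_map_axioms_def)
  have 1: "(\<exists>B. jordan_basis M T B) \<longleftrightarrow> (\<forall>m. complementary M (T ^^ m))"
    using complementary_if_jordan_basis jordan_basis_if_complementary by blast
  have 2: "(\<exists>B. jordan_basis M T B) \<longleftrightarrow> {B. jordan_basis M T B} =
      {orbit_set M T A | A. K_minimal_basis M T (contraction M (image_set M T)) A}"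
    using jordan_bases_eq_orbits jordan_basis_if_eq_orbits by (intro iffI) (elim exE)
  have 3: "(\<exists>B. jordan_basis M T B) \<longleftrightarrow> {B. jordan_basis M T B} =
      {P. \<exists>A. I_maximal_basis M T n (restriction M (kernel_set M T)) A \<and> is_preorbit_set M T A P}"
    using jordan_bases_eq_preorbits jordan_basis_if_eq_preorbits by (intro iffI) (elim exE)
  \<comment> \<open>Each of (2), (3) and (4) is replaced by the existence of a Jordan basis, which
    makes the equivalences trivial.\<close>
  show ?thesis unfolding 1[symmetric] 2[symmetric] 3[symmetric] by simp
qed

end
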